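(* Let $1\le k\le n$, let $f$ be a real-valued differentiable function on a neighborhood $\mathrm{St}_\delta(k,n)$ of $\mathrm{St}(k,n)$, and suppose that the NEPv Ansatz holds for $f$ with a symmetric matrix-valued function $H(P)\in\mathbb{R}^{n\times n}$ and a subset $\mathbb{P}\subseteq\mathrm{St}(k,n)$. Let the sequence $\{P^{(i)}\}_{i=0}^\infty$ be generated by Algorithm NEPvSCF (described in the context) from some $P^{(0)}\in\mathbb{P}$. Then: (a) The sequence $\{f(P^{(i)})\}_{i=0}^\infty$ is monotonically increasing (i.e. nondecreasing) and convergent. (b) Any accumulation point $P_*$ of the sequence $\{P^{(i)}\}_{i=0}^\infty$ satisfies the following necessary conditions for a global maximizer of $f$ over $\mathrm{St}(k,n)$: $H(P_* )P_*=P_*\Omega_*$ with $\Omega_*=P_*^{\mathrm T}H(P_* )P_*$, and the eigenvalues of $\Omega_*$ consist of the first $k$ largest eigenvalues of $H(P_* )$. Furthermore, in the case when $H$ satisfies $$H(P)P-\frac{\partial f(P)}{\partial P}=P\,\mathcal{M}(P)\quad\text{for } P\in\mathrm{St}(k,n)$$ for some matrix-valued function $\mathcal{M}(P)\in\mathbb{R}^{k\times k}$, if $\mathcal{M}(P_* )$ is symmetric, then $P_*$ is a KKT point of $\max_{P\in\mathrm{St}(k,n)}f(P)$. (c) The following two series converge: $$\sum_{i=1}^\infty\delta_i\,\big\|\sin\Theta\big(\mathcal{R}(P^{(i+1)}),\mathcal{R}(P^{(i)})\big)\big\|_{\mathrm F}^2<\infty,\qquad \sum_{i=1}^\infty\delta_i\,\frac{\big\|H(P^{(i)})P^{(i)}-P^{(i)}\Lambda_i\big\|_{\mathrm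 F}^2}{\big\|H(P^{(i)})\big\|_{\mathrm F}^2}<\infty,$$ where $\delta_i=\lambda_k(H(P^{(i)}))-\lambda_{k+1}(H(P^{(i)}))$ and $\Lambda_i=[P^{(i)}]^{\mathrm T}H(P^{(i)})P^{(i)}$.
   Context: $\mathrm{St}(k,n)=\{P\in\mathbb{R}^{n\times k}: P^{\mathrm T}P=I_k\}$; $\mathrm{St}_\delta(k,n)=\{P\in\mathbb{R}^{n\times k}:\|P^{\mathrm T}P-I_k\|<\delta\}$ for some constant $\delta>0$ and some matrix norm. Eigenvalues of a symmetric $A\in\mathbb{R}^{n\times n}$ are ordered $\lambda_1(A)\ge\cdots\ge\lambda_n(A)$, counted with multiplicity. $\mathcal{R}(B)$ is the column space of $B$; $\|\cdot\|_{\mathrm F}$ is the Frobenius norm. $\partial f(P)/\partial P$ is the $n\times k$ matrix of partial derivatives with all entries of $P$ treated as independent. $P\in\mathrm{St}(k,n)$ is a KKT point of $\max_{P\in\mathrm{St}(k,n)}f(P)$ if $\partial f(P)/\partial P=P\Lambda$ for some symmetric $\Lambda\in\mathbb{R}^{k\times k}$. Canonical angles: for $X,Y\in\mathrm{St}(k,n)$, $\Theta(\mathcal{R}(X),\mathcal{R}(Y))$ is the diagonal matrix of the angles $\theta_i=\arccos\sigma_i(X^{\mathrm T}Y)\in[0,\pi/2]$, $1\le i\le k$, where $\sigma_i(\cdot)$ denotes singular values, and $\|\sin\Theta\|_{\mathrm F}=(\sum_{i=1}^k\sin^2\theta_i)^{1/2}$. NEPv Ansatz (for $f$ with $H$ and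 $\mathbb{P}$): there is a constant $\omega>0$ (independent of $P$ and $\widehat P$) such that whenever $P\in\mathbb{P}$, $\widehat P\in\mathrm{St}(k,n)$ and $\eta\in\mathbb{R}$ satisfy $\mathrm{tr}(\widehat P^{\mathrm T}H(P)\widehat P)\ge\mathrm{tr}(P^{\mathrm T}H(P)P)+\eta$, there exists $Q\in\mathrm{St}(k,k)$ such that $\widetilde P=\widehat PQ\in\mathbb{P}$ and $f(\widetilde P)\ge f(P)+\omega\eta$. Algorithm NEPvSCF: given $P^{(0)}\in\mathbb{P}$, for $i=0,1,2,\dots$ (run indefinitely): let $\widehat P^{(i)}\in\mathrm{St}(k,n)$ be an orthonormal basis matrix of the eigenspace (invariant subspace) of $H(P^{(i)})$ associated with its first $k$ largest eigenvalues; take $Q_i\in\mathrm{St}(k,k)$ as supplied by the NEPv Ansatz for $P=P^{(i)}$, $\widehat P=\widehat P^{(i)}$ and $\eta=\eta_i:=\mathrm{tr}([\widehat P^{(i)}]^{\mathrm T}H(P^{(i)})\widehat P^{(i)})-\mathrm{tr}([P^{(i)}]^{\mathrm T}H(P^{(i)})P^{(i)})$, i.e. such that $P^{(i+1)}:=\widehat P^{(i)}Q_i\in\mathbb{P}$ and $f(P^{(i+1)})\ge f(P^{(i)})+\omega\eta_i$.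
   Formalization: Part (b) is proved for accumulation points at which H, restricted to St(k,n), is continuous (it is false for arbitrary H); the conditions are shown necessary for global maximizers of f lying in the subset ℙ (outside ℙ the Ansatz says nothing). *)

theory Defs
  imports "HOL-Analysis.Analysis"
begin

text \<open>An \<open>n \<times> k\<close> real matrix has type \<open>real^'k^'n\<close> with \<open>n = CARD('n)\<close> and \<open>k = CARD('k)\<close>.
  The library norm on such a matrix is the Frobenius norm:\<close>

lemma norm_matrix_Frobenius:
  fixes A :: "real^'k^'n"
  shows "norm A = sqrt (\<Sum>i\<in>UNIV. \<Sum>j\<in>UNIV. (A $ i $ j)\<^sup>2)"
  by (simp add: norm_vec_def L2_set_def sum_nonneg)

definition symmetric_matrix :: "real^'n^'n \<Rightarrow> bool" where
  "symmetric_matrix A \<longleftrightarrow> transpose A = A"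

subsection \<open>The Stiefel manifold and its neighbourhoods\<close>

definition St :: "(real^'k^'n) set" where
  "St = {P. transpose P ** P = mat 1}"

definition matrix_norm :: "(real^'m^'n \<Rightarrow> real) \<Rightarrow> bool" where
  "matrix_norm N \<longleftrightarrow>
     (\<forall>A. 0 \<le> N A) \<and> (\<forall>A. N A = 0 \<longleftrightarrow> A = 0) \<and>
     (\<forall>c A. N (c *\<^sub>R A) = \<bar>c\<bar> * N A) \<and> (\<forall>A B. N (A + B) \<le> N A + N B)"

definition St_nbhd :: "(real^'k^'k \<Rightarrow> real) \<Rightarrow> real \<Rightarrow> (real^'k^'n) set" where
  "St_nbhd N \<delta> = {P. N (transpose P ** P - mat 1) < \<delta>}"

subsection \<open>Eigenvalues, singular values and canonical angles\<close>

definition charpoly :: "real^'n^'n \<Rightarrow> real poly" where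
  "charpoly A = det (mat [:0, 1:] - map_matrix (\<lambda>a. [:a:]) A)"

text \<open>Real eigenvalues, repeated according to multiplicity, in descending order. For symmetric
  \<open>A\<close> (the only case used below) all roots of the characteristic polynomial are real, so the
  list has length \<open>CARD('n)\<close>.\<close>

definition eigvals :: "real^'n^'n \<Rightarrow> real list" where
  "eigvals A = rev (sorted_list_of_multiset (proots (charpoly A)))"

text \<open>\<open>eigval A j\<close> is \<open>\<lambda>\<^sub>j(A)\<close>, with \<open>j\<close> counted from 1. Outside \<open>1 \<le> j \<le> n\<close> the value is set to 0;
  this matters only for \<open>\<lambda>\<^sub>k\<^sub>+\<^sub>1\<close> when \<open>k = n\<close>, where every quantity it multiplies vanishes.\<close>

definition eigval :: "real^'n^'n \<Rightarrow> nat \<Rightarrow> real" where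
  "eigval A j = (if 1 \<le> j \<and> j \<le> length (eigvals A) then eigvals A ! (j - 1) else 0)"

definition singvals :: "real^'k^'k \<Rightarrow> real list" where
  "singvals M = map sqrt (eigvals (transpose M ** M))"

definition canonical_angles :: "real^'k^'n \<Rightarrow> real^'k^'n \<Rightarrow> real list" where
  "canonical_angles X Y = map arccos (singvals (transpose X ** Y))"

definition norm_sin_Theta :: "real^'k^'n \<Rightarrow> real^'k^'n \<Rightarrow> real" where
  "norm_sin_Theta X Y = sqrt (\<Sum>\<theta>\<leftarrow>canonical_angles X Y. (sin \<theta>)\<^sup>2)"

text \<open>\<open>X\<close> is an orthonormal basis matrix of an invariant subspace of \<open>A\<close> belonging to its first
  \<open>k\<close> largest eigenvalues. That subspace is not unique if \<open>\<lambda>\<^sub>k = \<lambda>\<^sub>k\<^sub>+\<^sub>1\<close>; then any choice is allowed.\<close>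

definition top_eigenbasis :: "real^'n^'n \<Rightarrow> real^'k^'n \<Rightarrow> bool" where
  "top_eigenbasis A X \<longleftrightarrow>
     X \<in> St \<and> (\<exists>\<Omega>. A ** X = X ** \<Omega> \<and> eigvals \<Omega> = take CARD('k) (eigvals A))"

subsection \<open>Optimality conditions\<close>

definition matrix_unit :: "'n \<Rightarrow> 'k \<Rightarrow> real^'k^'n" where
  "matrix_unit i j = axis i (axis j 1)"

definition partial_matrix :: "(real^'k^'n \<Rightarrow> real) \<Rightarrow> real^'k^'n \<Rightarrow> real^'k^'n" where
  "partial_matrix f P = (\<chi> i j. deriv (\<lambda>t. f (P + t *\<^sub>R matrix_unit i j)) 0)"

definition KKT_point :: "(real^'k^'n \<Rightarrow> real) \<Rightarrow> real^'k^'n \<Rightarrow> bool" where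
  "KKT_point f P \<longleftrightarrow>
     P \<in> St \<and> (\<exists>\<Lambda>. symmetric_matrix \<Lambda> \<and> partial_matrix f P = P ** \<Lambda>)"

definition NEPv_condition :: "(real^'k^'n \<Rightarrow> real^'n^'n) \<Rightarrow> real^'k^'n \<Rightarrow> bool" where
  "NEPv_condition H P \<longleftrightarrow>
     (let \<Omega> = transpose P ** H P ** P
      in H P ** P = P ** \<Omega> \<and> eigvals \<Omega> = take CARD('k) (eigvals (H P)))"

subsection \<open>The NEPv Ansatz and the SCF iteration\<close>

text \<open>The Ansatz constant \<open>\<omega>\<close> is a parameter because the iteration refers to the same \<open>\<omega>\<close>.\<close>

definition NEPv_Ansatz ::
    "real \<Rightarrow> (real^'k^'n \<Rightarrow> real) \<Rightarrow> (real^'k^'n \<Rightarrow> real^'n^'n) \<Rightarrow> (real^'k^'n) set \<Rightarrow> bool" where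
  "NEPv_Ansatz \<omega> f H PP \<longleftrightarrow> \<omega> > 0 \<and>
     (\<forall>P\<in>PP. \<forall>Phat\<in>St. \<forall>\<eta>.
        trace (transpose Phat ** H P ** Phat) \<ge> trace (transpose P ** H P ** P) + \<eta> \<longrightarrow>
        (\<exists>Q\<in>(St :: (real^'k^'k) set). Phat ** Q \<in> PP \<and> f (Phat ** Q) \<ge> f P + \<omega> * \<eta>))"

definition NEPvSCF ::
    "real \<Rightarrow> (real^'k^'n \<Rightarrow> real) \<Rightarrow> (real^'k^'n \<Rightarrow> real^'n^'n) \<Rightarrow> (real^'k^'n) set
      \<Rightarrow> (nat \<Rightarrow> real^'k^'n) \<Rightarrow> bool" where
  "NEPvSCF \<omega> f H PP P \<longleftrightarrow> P 0 \<in> PP \<and>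
     (\<forall>i. \<exists>Phat. \<exists>Q\<in>(St :: (real^'k^'k) set). top_eigenbasis (H (P i)) Phat \<and>
        P (Suc i) = Phat ** Q \<and> P (Suc i) \<in> PP \<and>
        f (P (Suc i)) \<ge> f (P i) +
          \<omega> * (trace (transpose Phat ** H (P i) ** Phat) - trace (transpose (P i) ** H (P i) ** P i)))"

end

theory Submission
  imports Defs
begin

text \<open>Ky Fan's principle drives everything. If \<open>X\<close> is a top eigenbasis of a symmetric \<open>A\<close> and \<open>Y\<close> has
  orthonormal columns, expand both traces in an orthonormal eigenbasis of \<open>A\<close> containing a basis of
  the range of \<open>X\<close>: the weights \<open>\<parallel>Y\<^sup>T b\<parallel>\<^sup>2 \<in> [0, 1]\<close> of the basis vectors sum to \<open>k\<close>, which gives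
  \<open>tr (X\<^sup>T A X) - tr (Y\<^sup>T A Y) \<ge> (\<lambda>\<^sub>k - \<lambda>\<^sub>k\<^sub>+\<^sub>1) \<parallel>sin \<Theta>\<parallel>\<^sup>2\<close>. Since \<open>f\<close> is bounded on the compact Stiefel
  manifold, the gains of \<open>f\<close> telescope to a convergent series and dominate both series of (c).

  For (b), comparing with an arbitrary \<open>Y\<close> instead of the top eigenbasis lets one pass to the limit
  without continuity of eigenvalues: an accumulation point maximises \<open>tr (Y\<^sup>T H Y)\<close> for its own \<open>H\<close>, and
  so does a global maximiser of \<open>f\<close> by the Ansatz. Rotating a unit vector of the range of a trace
  maximiser towards its orthogonal complement shows that the range is invariant and belongs to the
  largest eigenvalues.\<close>

subsection \<open>Orthonormal eigenbases of symmetric matrices\<close>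

lemma inner_matrix_vector_mult: "x \<bullet> ((A::real^'m^'n) *v y) = (transpose A *v x) \<bullet> y"
  by (simp add: dot_lmul_matrix)

lemma symmetric_matrix_inner:
  "symmetric_matrix A \<Longrightarrow> (A *v x) \<bullet> y = x \<bullet> (A *v y)"
  by (simp add: inner_matrix_vector_mult symmetric_matrix_def)

definition orthonormal :: "'a::real_inner set \<Rightarrow> bool" where
  "orthonormal S \<longleftrightarrow> pairwise orthogonal S \<and> (\<forall>x\<in>S. norm x = 1)"

text \<open>For a unit vector the eigenvalue equals the Rayleigh quotient, so this form needs no
  separate function assigning eigenvalues to basis vectors.\<close>

definition eigenset :: "real^'n^'n \<Rightarrow> (real^'n) set \<Rightarrow> bool" where
  "eigenset A S \<longleftrightarrow> orthonormal S \<and> (\<forall>x\<in>S. A *v x = (x \<bullet> (A *v x)) *\<^sub>R x)"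

lemma orthonormal_independent: "orthonormal S \<Longrightarrow> independent S"
  for S :: "'a::euclidean_space set"
  by (rule pairwise_orthogonal_independent) (auto simp: orthonormal_def)

lemma orthonormal_finite: "orthonormal S \<Longrightarrow> finite S"
  for S :: "'a::euclidean_space set"
  by (simp add: orthonormal_def pairwise_orthogonal_imp_finite)

lemma orthonormal_card_le: "orthonormal S \<Longrightarrow> card S \<le> DIM('a)"
  for S :: "'a::euclidean_space set"
  using independent_bound orthonormal_independent by blast

lemma orthonormal_span: "orthonormal S \<Longrightarrow> card S = DIM('a) \<Longrightarrow> span S = UNIV"
  for S :: "'a::euclidean_space set"
  by (metis dim_eq_card_independent dim_eq_full orthonormal_independent)

lemma orthonormal_inner:
  "orthonormal S \<Longrightarrow> x \<in> S \<Longrightarrow> y \<in> S \<Longrightarrow> x \<bullet> y = (if x = y then 1 else 0)"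
  by (auto simp: orthonormal_def pairwise_def orthogonal_def dot_square_norm)

lemma orthonormal_insert:
  "orthonormal S \<Longrightarrow> norm x = 1 \<Longrightarrow> \<forall>s\<in>S. s \<bullet> x = 0 \<Longrightarrow> orthonormal (insert x S)"
  by (auto simp: orthonormal_def pairwise_insert orthogonal_def inner_commute)

lemma orthonormal_subset: "orthonormal S \<Longrightarrow> T \<subseteq> S \<Longrightarrow> orthonormal T"
  by (auto simp: orthonormal_def pairwise_def)

text \<open>For small \<open>t\<close> the linear term dominates: at \<open>t = - b / D\<close> with
  \<open>D\<close> positive and larger than \<open>c\<close> the value would be negative. This
  serves as the first-order optimality condition in both variational arguments below.\<close>

lemma quadratic_nonneg_linear_coeff_zero:
  fixes b c :: real
  assumes "\<And>t. 0 \<le> t * b + t\<^sup>2 * c"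
  shows "b = 0"
proof (rule ccontr)
  assume "b \<noteq> 0"
  define D where "D = \<bar>c\<bar> + 1"
  have D: "D > 0" "c < D" by (auto simp: D_def)
  have "(- b / D) * b + (- b / D)\<^sup>2 * c = (b\<^sup>2 / D) * (c / D - 1)"
    using D by (simp add: field_simps power2_eq_square)
  moreover have "\<dots> < 0"
    using D \<open>b \<noteq> 0\<close> by (intro mult_pos_neg) auto
  ultimately show False using assms[of "- b / D"] by linarith
qed

text \<open>The orthogonal complement of \<open>S\<close> is invariant under \<open>A\<close>, and
  its unit sphere is compact and nonempty. A maximiser of the Rayleigh quotient there is an
  eigenvector.\<close>

lemma eigenvector_in_complement:
  fixes A :: "real^'n^'n"
  assumes "symmetric_matrix A" "eigenset A S" "span S \<noteq> UNIV"
  obtains x where "norm x = 1" "\<forall>s\<in>S. s \<bullet> x = 0" "A *v x = (x \<bullet> (A *v x)) *\<^sub>R x"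
proof -
  define W where "W = {x. \<forall>s\<in>S. s \<bullet> x = 0}"
  have W_add: "x + t *\<^sub>R y \<in> W" if "x \<in> W" "y \<in> W" for x y t
    using that by (auto simp: W_def inner_add_right)
  have AW: "A *v x \<in> W" if "x \<in> W" for x
    using assms(1,2) that
    by (auto simp: W_def eigenset_def symmetric_matrix_inner[symmetric])
       (metis inner_scaleR_left mult_zero_right)
  have "W = (\<Inter>s\<in>S. {x. s \<bullet> x = 0})" by (auto simp: W_def)
  then have "closed W" by (auto intro!: closed_INT closed_hyperplane)
  then have "compact (sphere 0 1 \<inter> W)" by (intro compact_Int_closed) auto
  moreover obtain a where "a \<noteq> 0" "\<forall>x\<in>span S. a \<bullet> x = 0"
    using span_not_UNIV_orthogonal[OF assms(3)] by blast
  then have "a /\<^sub>R norm a \<in> sphere 0 1 \<inter> W"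
    by (auto simp: W_def inner_commute span_base)
  then have "sphere 0 1 \<inter> W \<noteq> {}" by blast
  moreover have "continuous_on (sphere 0 1 \<inter> W) (\<lambda>y. y \<bullet> (A *v y))"
    by (intro continuous_intros linear_continuous_on_compose matrix_vector_mul_linear)
  ultimately obtain x where "x \<in> sphere 0 1 \<inter> W"
    "\<forall>y\<in>sphere 0 1 \<inter> W. y \<bullet> (A *v y) \<le> x \<bullet> (A *v x)"
    using continuous_attains_sup by blast
  then have x: "norm x = 1" "x \<in> W"
    and max: "\<And>y. norm y = 1 \<Longrightarrow> y \<in> W \<Longrightarrow> y \<bullet> (A *v y) \<le> x \<bullet> (A *v x)"
    by auto
  define m where "m = x \<bullet> (A *v x)"
  \<comment> \<open>Homogeneity extends the maximality from unit vectors to all of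
    \<open>W\<close>.\<close>
  have le: "y \<bullet> (A *v y) \<le> m * (y \<bullet> y)" if "y \<in> W" for y
  proof (cases "y = 0")
    case False
    have "y /\<^sub>R norm y \<in> W" using that by (auto simp: W_def)
    with max[of "y /\<^sub>R norm y"] False
    have "(y /\<^sub>R norm y) \<bullet> (A *v (y /\<^sub>R norm y)) \<le> m" by (auto simp: m_def)
    then have "(y \<bullet> (A *v y)) / (norm y)\<^sup>2 \<le> m"
      by (simp add: matrix_vector_mult_scaleR power2_eq_square field_simps)
    then show ?thesis
      using False by (simp add: divide_le_eq dot_square_norm split: if_splits)
  qed auto
  \<comment> \<open>The first-order condition at \<open>x\<close> in a direction \<open>y\<close> of
    \<open>W\<close>: the inequality \<open>le\<close> along the line
    \<open>x + t *\<^sub>R y\<close> is a nonnegative quadratic in \<open>t\<close> without constant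
    term.\<close>
  have crit: "2 * (m * (x \<bullet> y) - y \<bullet> (A *v x)) = 0" if "y \<in> W" for y
  proof (rule quadratic_nonneg_linear_coeff_zero)
    fix t :: real
    have "(x + t *\<^sub>R y) \<bullet> (A *v (x + t *\<^sub>R y)) \<le> m * ((x + t *\<^sub>R y) \<bullet> (x + t *\<^sub>R y))"
      using le W_add x that by blast
    moreover have "x \<bullet> (A *v y) = y \<bullet> (A *v x)"
      using assms(1) by (metis symmetric_matrix_inner inner_commute)
    moreover have "x \<bullet> x = 1" using x by (simp add: dot_square_norm)
    ultimately show "0 \<le> t * (2 * (m * (x \<bullet> y) - y \<bullet> (A *v x)))
        + t\<^sup>2 * (m * (y \<bullet> y) - y \<bullet> (A *v y))"
      by (simp add: inner_add_left inner_add_right matrix_vector_right_distrib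
          matrix_vector_mult_scaleR inner_commute[of y x] m_def[symmetric] algebra_simps
          power2_eq_square)
  qed
  \<comment> \<open>The eigenvector residual lies in \<open>W\<close> itself, so it may be used as
    the direction in \<open>crit\<close>, which forces its norm to vanish.\<close>
  define z where "z = A *v x - m *\<^sub>R x"
  have "z \<in> W" using W_add[OF AW[OF x(2)] x(2), of "-m"] by (simp add: z_def)
  then have "m * (x \<bullet> z) = z \<bullet> (A *v x)" using crit by force
  moreover have "z \<bullet> z = z \<bullet> (A *v x) - m * (x \<bullet> z)"
    by (subst (2) z_def) (simp add: inner_diff_right inner_commute)
  ultimately have "z \<bullet> z = 0" by simp
  then have "A *v x = m *\<^sub>R x" by (simp add: z_def)
  with x that show ?thesis by (auto simp: W_def m_def)
qed

text \<open>Spectral theorem with part of the basis prescribed, by induction on the number of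
  missing vectors; \<open>S = {}\<close> gives the usual form.\<close>

lemma eigenset_extend:
  fixes A :: "real^'n^'n"
  assumes "symmetric_matrix A" "eigenset A S"
  obtains B where "S \<subseteq> B" "eigenset A B" "card B = CARD('n)"
  using assms(2)
proof (induction "CARD('n) - card S" arbitrary: S thesis rule: less_induct)
  case less
  have fin: "finite S" and le: "card S \<le> CARD('n)"
    using less.prems orthonormal_finite orthonormal_card_le[of S] by (auto simp: eigenset_def)
  show ?case
  proof (cases "card S = CARD('n)")
    case False
    have "span S \<noteq> UNIV"
      using fin le False dim_le_card'[of S] dim_eq_full[of S] by auto
    then obtain x where x: "norm x = 1" "\<forall>s\<in>S. s \<bullet> x = 0" "A *v x = (x \<bullet> (A *v x)) *\<^sub>R x"
      using eigenvector_in_complement assms(1) less.prems by metis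
    have "x \<notin> S" using x by (auto simp: dot_square_norm)
    then have "CARD('n) - card (insert x S) < CARD('n) - card S"
      using fin le False by simp
    moreover have "eigenset A (insert x S)"
      using less.prems x orthonormal_insert by (auto simp: eigenset_def)
    ultimately obtain B where "insert x S \<subseteq> B" "eigenset A B" "card B = CARD('n)"
      using less.hyps by metis
    with less.prems show ?thesis by blast
  qed (use less.prems in blast)
qed

subsection \<open>Traces, norms and eigenvalues in an orthonormal basis\<close>

declare transpose_matrix_vector [simp del]

lemma eigenset_mat_1: "eigenset (mat 1) S \<longleftrightarrow> orthonormal S"
  by (auto simp: eigenset_def orthonormal_def dot_square_norm)

text \<open>Every vector is an eigenvector of the identity, so completing an orthonormal set is a
  special case of extending an eigenset.\<close>

lemma orthonormal_basis_containing:
  fixes S :: "(real^'n) set"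
  assumes "orthonormal S"
  obtains B where "S \<subseteq> B" "orthonormal B" "card B = CARD('n)"
  using eigenset_extend[of "mat 1" S] assms
  by (auto simp: eigenset_mat_1 symmetric_matrix_def)

lemma orthonormal_parseval:
  fixes x y :: "'a::euclidean_space"
  assumes "orthonormal B" "card B = DIM('a)"
  shows "(\<Sum>b\<in>B. (b \<bullet> x) * (b \<bullet> y)) = x \<bullet> y"
proof -
  have "(\<Sum>b\<in>B. (x \<bullet> b) *\<^sub>R b) = x"
    using assms orthonormal_span[OF assms] orthonormal_finite[OF assms(1)]
    by (intro orthonormal_basis_expand) (auto simp: orthonormal_def)
  then have "x \<bullet> y = (\<Sum>b\<in>B. (x \<bullet> b) *\<^sub>R b) \<bullet> y" by simp
  then show ?thesis by (simp add: inner_sum_left inner_commute[of x])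
qed

lemma matrix_entry_inner:
  fixes M :: "real^'m^'n"
  shows "M $ i $ j = axis i 1 \<bullet> (M *v axis j 1)"
  by (simp add: inner_axis' column_def matrix_vector_mult_basis)

text \<open>Parseval is applied to each diagonal entry in the standard basis; after swapping the
  sums the standard coordinates recombine into inner products.\<close>

lemma trace_orthonormal:
  fixes M :: "real^'n^'n"
  assumes "orthonormal B" "card B = CARD('n)"
  shows "trace M = (\<Sum>b\<in>B. b \<bullet> (M *v b))"
proof -
  have "trace M = (\<Sum>i\<in>UNIV. axis i 1 \<bullet> (M *v axis i 1))"
    by (simp add: trace_def matrix_entry_inner)
  also have "\<dots> = (\<Sum>i\<in>UNIV. \<Sum>b\<in>B. (b \<bullet> axis i 1) * (b \<bullet> (M *v axis i 1)))"
    using assms by (simp add: orthonormal_parseval)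
  also have "\<dots> = (\<Sum>b\<in>B. \<Sum>i\<in>UNIV. b $ i * (transpose M *v b) $ i)"
    by (subst sum.swap) (simp add: inner_axis inner_matrix_vector_mult)
  also have "\<dots> = (\<Sum>b\<in>B. b \<bullet> (transpose M *v b))" by (simp add: inner_vec_def)
  also have "\<dots> = (\<Sum>b\<in>B. b \<bullet> (M *v b))"
    by (simp add: inner_matrix_vector_mult[of _ "transpose M"] inner_commute)
  finally show ?thesis .
qed

lemma trace_transpose_mult_self:
  fixes M :: "real^'m^'n"
  shows "trace (transpose M ** M) = (norm M)\<^sup>2"
proof -
  have "trace (transpose M ** M) = (\<Sum>j\<in>UNIV. \<Sum>i\<in>UNIV. (M $ i $ j)\<^sup>2)"
    by (simp add: trace_def matrix_matrix_mult_def transpose_def power2_eq_square)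
  also have "\<dots> = (norm M)\<^sup>2"
    by (subst sum.swap) (simp add: norm_matrix_Frobenius sum_nonneg)
  finally show ?thesis .
qed

lemma norm_matrix_orthonormal:
  fixes M :: "real^'m^'n"
  assumes "orthonormal B" "card B = CARD('m)"
  shows "(norm M)\<^sup>2 = (\<Sum>b\<in>B. (norm (M *v b))\<^sup>2)"
  unfolding trace_transpose_mult_self[symmetric] trace_orthonormal[OF assms]
  by (simp only: matrix_vector_mul_assoc[symmetric] inner_matrix_vector_mult[of _ "transpose M"]
      transpose_transpose dot_square_norm)

section \<open>Characteristic polynomial and eigenvalue list\<close>

lemma mat_vector_mult: "mat c *v (x::real^'n) = c *\<^sub>R x"
  by (simp add: vec_eq_iff matrix_vector_mult_def mat_def if_distrib if_distribR cong: if_cong)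

lemma poly_charpoly: "poly (charpoly A) x = det (mat x - A)"
proof -
  have "poly ((mat [:0, 1:] - map_matrix (\<lambda>a. [:a:]) A) $ i $ j) x = (mat x - A) $ i $ j" for i j
    by (simp add: mat_def)
  then show ?thesis
    by (simp add: charpoly_def det_def poly_sum poly_prod)
qed

text \<open>The matrix \<open>U\<close> whose columns are the basis vectors is orthogonal and
  diagonalises \<open>mat x - A\<close>, so the determinants agree at every real \<open>x\<close>,
  which suffices for equality of real polynomials.\<close>

lemma charpoly_eigenset:
  fixes A :: "real^'n^'n"
  assumes "eigenset A B" "card B = CARD('n)"
  shows "charpoly A = (\<Prod>b\<in>B. [:- (b \<bullet> (A *v b)), 1:])"
proof -
  have on: "orthonormal B" using assms by (simp add: eigenset_def)
  obtain h :: "'n \<Rightarrow> real^'n" where h: "bij_betw h UNIV B"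
    using finite_same_card_bij[of "UNIV :: 'n set" B] assms(2) orthonormal_finite[OF on] by auto
  have hB: "h i \<in> B" for i using h by (auto simp: bij_betw_def)
  have hh: "h i \<bullet> h j = (if i = j then 1 else 0)" for i j
    using orthonormal_inner[OF on hB hB, of i j] h by (auto simp: bij_betw_def inj_on_def)
  define U :: "real^'n^'n" where "U = (\<chi> i j. h j $ i)"
  have Uh: "U *v axis i 1 = h i" for i
    by (simp add: U_def matrix_vector_mult_basis column_def)
  have ent: "(transpose U ** M ** U) $ i $ j = h i \<bullet> (M *v h j)" for M i j
    by (subst matrix_entry_inner)
       (simp only: matrix_vector_mul_assoc[symmetric] Uh inner_matrix_vector_mult[of _ "transpose U"]
         transpose_transpose)
  have "transpose U ** mat 1 ** U = mat 1"
    by (simp only: vec_eq_iff ent hh matrix_vector_mul_lid) (simp add: mat_def)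
  then have detU: "det (transpose U) * det U = 1"
    by (metis det_I det_mul matrix_mul_rid)
  have "poly (charpoly A) x = poly (\<Prod>b\<in>B. [:- (b \<bullet> (A *v b)), 1:]) x" for x
  proof -
    have Ah: "A *v h j = (h j \<bullet> (A *v h j)) *\<^sub>R h j" for j
      using assms(1) hB by (auto simp: eigenset_def)
    have "h i \<bullet> ((mat x - A) *v h j) = (if i = j then x - h j \<bullet> (A *v h j) else 0)" for i j
    proof -
      have "h i \<bullet> ((mat x - A) *v h j) = x * (h i \<bullet> h j) - h i \<bullet> (A *v h j)"
        by (simp add: matrix_vector_mult_diff_rdistrib inner_diff_right mat_vector_mult)
      also have "h i \<bullet> (A *v h j) = (h j \<bullet> (A *v h j)) * (h i \<bullet> h j)"
        by (metis Ah inner_scaleR_right)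
      finally show ?thesis by (simp add: hh)
    qed
    then have "det (transpose U ** (mat x - A) ** U) = (\<Prod>j\<in>UNIV. x - h j \<bullet> (A *v h j))"
      by (subst det_diagonal) (simp_all add: ent)
    moreover have "det (transpose U ** (mat x - A) ** U) = det (mat x - A)"
      using detU by (simp add: det_mul mult.assoc mult.left_commute)
    ultimately show ?thesis
      using prod.reindex_bij_betw[OF h, of "\<lambda>b. x - b \<bullet> (A *v b)"]
      by (simp add: poly_charpoly poly_prod)
  qed
  then show ?thesis by (simp add: poly_eq_poly_eq_iff[symmetric] fun_eq_iff)
qed

lemma proots_charpoly:
  fixes A :: "real^'n^'n"
  assumes "eigenset A B" "card B = CARD('n)"
  shows "proots (charpoly A) = image_mset (\<lambda>b. b \<bullet> (A *v b)) (mset_set B)"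
  unfolding charpoly_eigenset[OF assms]
  by (subst proots_prod) (simp_all add: sum_unfold_sum_mset)

lemma mset_eigvals:
  fixes A :: "real^'n^'n"
  assumes "eigenset A B" "card B = CARD('n)"
  shows "mset (eigvals A) = image_mset (\<lambda>b. b \<bullet> (A *v b)) (mset_set B)"
  by (simp add: eigvals_def proots_charpoly[OF assms])

lemma sum_list_eigvals:
  fixes A :: "real^'n^'n"
  assumes "eigenset A B" "card B = CARD('n)"
  shows "(\<Sum>e\<leftarrow>eigvals A. g e) = (\<Sum>b\<in>B. g (b \<bullet> (A *v b)))"
proof -
  have "(\<Sum>e\<leftarrow>eigvals A. g e) = sum_mset (image_mset g (mset (eigvals A)))"
    by (metis mset_map sum_mset_sum_list)
  then show ?thesis
    by (simp add: mset_eigvals[OF assms] sum_unfold_sum_mset image_mset.compositionality comp_def)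
qed

lemma length_eigvals:
  fixes A :: "real^'n^'n"
  assumes "symmetric_matrix A"
  shows "length (eigvals A) = CARD('n)"
proof -
  have "eigenset A {}" by (simp add: eigenset_def orthonormal_def)
  then obtain B where "eigenset A B" "card B = CARD('n)"
    using eigenset_extend[OF assms] by blast
  then show ?thesis
    using arg_cong[OF mset_eigvals[of A B], of size] by simp
qed

lemma sorted_eigvals: "sorted (rev (eigvals A))"
  by (simp add: eigvals_def)

subsection \<open>Trace maximisers over the Stiefel manifold\<close>

lemma St_iff: "Y \<in> St \<longleftrightarrow> transpose Y ** Y = mat 1"
  by (simp add: St_def)

lemma St_inner: "Y \<in> St \<Longrightarrow> (Y *v x) \<bullet> (Y *v y) = x \<bullet> y"
  by (simp add: inner_matrix_vector_mult matrix_vector_mul_assoc St_iff)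

lemma St_norm_vec: "Y \<in> St \<Longrightarrow> norm (Y *v x) = norm x"
  by (simp add: norm_eq_sqrt_inner St_inner)

text \<open>Cauchy-Schwarz for \<open>x\<close> and \<open>Y *v (transpose Y *v x)\<close>, whose
  inner product is the squared left-hand norm.\<close>

lemma St_norm_transpose_le:
  assumes "Y \<in> St"
  shows "norm (transpose Y *v x) \<le> norm x"
proof -
  have "(norm (transpose Y *v x))\<^sup>2 = (transpose Y *v x) \<bullet> (transpose Y *v x)"
    by (simp add: power2_norm_eq_inner)
  also have "\<dots> = x \<bullet> (Y *v (transpose Y *v x))"
    by (simp add: inner_matrix_vector_mult)
  also have "\<dots> \<le> norm x * norm (transpose Y *v x)"
    using norm_cauchy_schwarz[of x "Y *v (transpose Y *v x)"] by (simp add: St_norm_vec[OF assms])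
  finally show ?thesis
    by (cases "norm (transpose Y *v x) = 0") (auto simp: power2_eq_square)
qed

lemma St_image_orthonormal:
  assumes "Y \<in> St" "orthonormal B"
  shows "orthonormal ((*v) Y ` B)" "inj_on ((*v) Y) B"
proof -
  have inj: "inj ((*v) Y)"
  proof (rule injI)
    fix x y assume "Y *v x = Y *v y"
    then have "norm (x - y) = 0"
      by (simp flip: St_norm_vec[OF assms(1)] add: matrix_vector_mult_diff_distrib)
    then show "x = y" by simp
  qed
  then show "inj_on ((*v) Y) B" by (rule inj_on_subset) simp
  show "orthonormal ((*v) Y ` B)"
    using assms(2)
    by (auto simp: orthonormal_def pairwise_def orthogonal_def St_inner[OF assms(1)] St_norm_vec[OF assms(1)])
qed

text \<open>Supplies competitors in trace comparisons: an orthonormal set is altered by hand and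
  then read as the columns of a point of \<open>St\<close>.\<close>

lemma St_of_orthonormal:
  fixes S :: "(real^'n) set"
  assumes "orthonormal S" "card S = CARD('k)"
  obtains Y :: "real^'k^'n" where "Y \<in> St"
    "\<And>A. trace (transpose Y ** A ** Y) = (\<Sum>s\<in>S. s \<bullet> (A *v s))"
proof -
  obtain h :: "'k \<Rightarrow> real^'n" where h: "bij_betw h UNIV S"
    using finite_same_card_bij[of "UNIV :: 'k set" S] assms orthonormal_finite by auto
  have hS: "h i \<in> S" for i using h by (auto simp: bij_betw_def)
  have hh: "h i \<bullet> h j = (if i = j then 1 else 0)" for i j
    using orthonormal_inner[OF assms(1) hS hS, of i j] h by (auto simp: bij_betw_def inj_on_def)
  define Y :: "real^'k^'n" where "Y = (\<chi> i j. h j $ i)"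
  have Yh: "Y *v axis i 1 = h i" for i
    by (simp add: Y_def matrix_vector_mult_basis column_def)
  have ent: "(transpose Y ** A ** Y) $ i $ j = h i \<bullet> (A *v h j)" for A i j
    by (subst matrix_entry_inner)
       (simp only: matrix_vector_mul_assoc[symmetric] Yh inner_matrix_vector_mult[of _ "transpose Y"]
         transpose_transpose)
  have "transpose Y ** mat 1 ** Y = mat 1"
    by (simp only: vec_eq_iff ent hh matrix_vector_mul_lid) (simp add: mat_def)
  then have "Y \<in> St" by (simp add: St_iff)
  moreover have "trace (transpose Y ** A ** Y) = (\<Sum>s\<in>S. s \<bullet> (A *v s))" for A
    using sum.reindex_bij_betw[OF h, of "\<lambda>s. s \<bullet> (A *v s)"] by (simp add: trace_def ent)
  ultimately show ?thesis using that by blast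
qed

lemma trace_congruence:
  fixes Y :: "real^'k^'n" and A :: "real^'n^'n"
  assumes "orthonormal C" "card C = CARD('k)"
  shows "trace (transpose Y ** A ** Y) = (\<Sum>c\<in>C. (Y *v c) \<bullet> (A *v (Y *v c)))"
  unfolding trace_orthonormal[OF assms]
  by (simp only: matrix_vector_mul_assoc[symmetric] inner_matrix_vector_mult[of _ "transpose Y"]
      transpose_transpose)

lemma symmetric_congruence:
  "symmetric_matrix A \<Longrightarrow> symmetric_matrix (transpose Y ** A ** Y)"
  by (simp add: symmetric_matrix_def matrix_transpose_mul matrix_mul_assoc)

text \<open>A sorted list is determined by its multiset, and \<open>M\<close> in ascending order
  followed by \<open>rev L'\<close> is sorted. This turns a splitting of the spectrum into a
  statement about its largest members.\<close>

lemma sorted_desc_eq_take: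
  fixes L L' :: "'a::linorder list"
  assumes "sorted (rev L)" "sorted (rev L')" "mset L = mset L' + M"
    and "\<And>x y. x \<in># M \<Longrightarrow> y \<in> set L' \<Longrightarrow> x \<le> y"
  shows "L' = take (length L') L"
proof -
  have "sorted (sorted_list_of_multiset M @ rev L')"
    using assms by (auto simp: sorted_append)
  moreover have "mset (sorted_list_of_multiset M @ rev L') = mset (rev L)"
    using assms by simp
  ultimately have "rev L = sorted_list_of_multiset M @ rev L'"
    using assms(1) properties_for_sort by metis
  then have "L = L' @ rev (sorted_list_of_multiset M)" by (metis rev_append rev_rev_ident)
  then show ?thesis by simp
qed

text \<open>An eigenbasis \<open>C\<close> of the small matrix is carried by \<open>X\<close> to
  eigenvectors of \<open>A\<close> with the same eigenvalues and then completed. The spectrum of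
  \<open>A\<close> splits accordingly into the part on the range of \<open>X\<close> and the
  rest.\<close>

lemma invariant_subspace_eigenset:
  fixes A :: "real^'n^'n" and X :: "real^'k^'n"
  assumes A: "symmetric_matrix A" and X: "X \<in> St" and AX: "A ** X = X ** \<Omega>"
  defines "q \<equiv> \<lambda>x. x \<bullet> (A *v x)"
  obtains C B where "orthonormal C" "card C = CARD('k)"
    "(*v) X ` C \<subseteq> B" "eigenset A B" "card B = CARD('n)"
    "mset (eigvals \<Omega>) = image_mset q (mset_set ((*v) X ` C))"
    "mset (eigvals A) = mset (eigvals \<Omega>) + image_mset q (mset_set (B - (*v) X ` C))"
proof -
  \<comment> \<open>Multiplying the invariance relation by \<open>transpose X\<close> shows that
    \<open>\<Omega>\<close> is the compression of \<open>A\<close>, hence symmetric.\<close>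
  have Om: "transpose X ** A ** X = \<Omega>"
    using X by (simp add: matrix_mul_assoc[symmetric] AX) (simp add: matrix_mul_assoc St_iff)
  have sym: "symmetric_matrix \<Omega>" using symmetric_congruence[OF A, of X] by (simp add: Om)
  obtain C where C: "eigenset \<Omega> C" "card C = CARD('k)"
    using eigenset_extend[OF sym, of "{}"] by (auto simp: eigenset_def orthonormal_def)
  then have onC: "orthonormal C" by (simp add: eigenset_def)
  define S where "S = (*v) X ` C"
  have onS: "orthonormal S" and inj: "inj_on ((*v) X) C"
    unfolding S_def using St_image_orthonormal[OF X onC] by auto
  have AXc: "A *v (X *v c) = X *v (\<Omega> *v c)" for c
    by (simp add: matrix_vector_mul_assoc AX)
  have qX: "q (X *v c) = c \<bullet> (\<Omega> *v c)" for c
    by (simp add: q_def AXc St_inner[OF X])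
  have "eigenset A S"
    unfolding eigenset_def
  proof (intro conjI ballI onS)
    fix s assume "s \<in> S"
    then obtain c where c: "c \<in> C" "s = X *v c" by (auto simp: S_def)
    have "A *v s = X *v ((c \<bullet> (\<Omega> *v c)) *\<^sub>R c)"
      using c C(1) by (metis AXc eigenset_def)
    also have "\<dots> = (s \<bullet> (A *v s)) *\<^sub>R s"
      using qX[of c] by (simp add: q_def c matrix_vector_mult_scaleR)
    finally show "A *v s = (s \<bullet> (A *v s)) *\<^sub>R s" .
  qed
  then obtain B where B: "S \<subseteq> B" "eigenset A B" "card B = CARD('n)"
    using eigenset_extend[OF A] by blast
  have "finite B" using B orthonormal_finite by (auto simp: eigenset_def)
  then have "mset_set B = mset_set S + mset_set (B - S)"
    using B(1) mset_set_Union[of S "B - S"] orthonormal_finite[OF onS] by (simp add: Un_absorb1)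
  moreover have "mset (eigvals \<Omega>) = image_mset q (mset_set S)"
    unfolding mset_eigvals[OF C] S_def image_mset_mset_set[OF inj, symmetric]
    using qX by (simp add: image_mset.compositionality comp_def)
  moreover from calculation
  have "mset (eigvals A) = mset (eigvals \<Omega>) + image_mset q (mset_set (B - S))"
    unfolding mset_eigvals[OF B(2,3)] by (simp add: q_def)
  ultimately show ?thesis using that[OF onC C(2), of B] B unfolding S_def by blast
qed

text \<open>The converse direction of Ky Fan's principle. Infinitesimal rotations out of the range
  give invariance; exchanging a whole basis vector gives the ordering of the eigenvalues.\<close>

lemma trace_maximizer_NEPv:
  fixes A :: "real^'n^'n" and X :: "real^'k^'n"
  defines "\<Omega> \<equiv> transpose X ** A ** X"
  assumes A: "symmetric_matrix A" and X: "X \<in> St"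
    and max: "\<And>Y :: real^'k^'n. Y \<in> St \<Longrightarrow> trace (transpose Y ** A ** Y) \<le> trace \<Omega>"
  shows "A ** X = X ** \<Omega>" "eigvals \<Omega> = take CARD('k) (eigvals A)"
proof -
  define q where "q = (\<lambda>x. x \<bullet> (A *v x))"
  have Xcw: "(X *v c) \<bullet> w = 0" if "transpose X *v w = 0" for c w
  proof -
    have "(X *v c) \<bullet> w = c \<bullet> (transpose X *v w)" by (simp add: inner_matrix_vector_mult)
    then show ?thesis by (simp add: that)
  qed
  \<comment> \<open>Exchange argument: complete \<open>c\<close> to an orthonormal basis, map it by
    \<open>X\<close>, and replace only \<open>X *v c\<close> by \<open>y\<close>. Since
    \<open>y\<close> is orthogonal to the remaining vectors the result is admissible, and the trace
    changes by \<open>q y - q (X *v c)\<close>.\<close>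
  have rot: "q y \<le> q (X *v c)"
    if c: "norm c = 1" and w: "transpose X *v w = 0"
      and y: "norm y = 1" "y = a *\<^sub>R (X *v c) + b *\<^sub>R w" for c w y a b
  proof -
    have "orthonormal {c}" using c by (simp add: orthonormal_def)
    then obtain C where C: "{c} \<subseteq> C" "orthonormal C" "card C = CARD('k)"
      by (rule orthonormal_basis_containing)
    define S where "S = (*v) X ` C"
    have onS: "orthonormal S" and inj: "inj_on ((*v) X) C"
      unfolding S_def using St_image_orthonormal[OF X C(2)] by auto
    have finS: "finite S" using orthonormal_finite[OF onS] .
    have cardS: "card S = CARD('k)" using C card_image[OF inj] by (simp add: S_def)
    have trS: "trace \<Omega> = (\<Sum>s\<in>S. q s)"
      unfolding \<Omega>_def trace_congruence[OF C(2,3)] S_def by (simp add: sum.reindex[OF inj] q_def)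
    define u where "u = X *v c"
    have u: "u \<in> S" using C by (auto simp: S_def u_def)
    have orth: "\<forall>s\<in>S - {u}. s \<bullet> y = 0"
      using u Xcw[OF w] orthonormal_inner[OF onS]
      by (auto simp: y(2) u_def[symmetric] S_def inner_add_right)
    then have "y \<notin> S - {u}" using y(1) by (metis norm_eq_zero inner_eq_zero_iff zero_neq_one)
    then have card': "card (insert y (S - {u})) = CARD('k)"
      using finS u cardS by (simp add: card_Suc_Diff1)
    have "orthonormal (insert y (S - {u}))"
      using orth y onS by (intro orthonormal_insert) (auto intro: orthonormal_subset)
    then obtain Y :: "real^'k^'n" where "Y \<in> St"
      "trace (transpose Y ** A ** Y) = (\<Sum>s\<in>insert y (S - {u}). q s)"
      using St_of_orthonormal[OF _ card'] unfolding q_def by metis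
    with max have "(\<Sum>s\<in>insert y (S - {u}). q s) \<le> (\<Sum>s\<in>S. q s)" by (metis trS)
    then show ?thesis
      using \<open>y \<notin> S - {u}\<close> finS u by (simp add: sum.remove[of S u] u_def)
  qed
  \<comment> \<open>\<open>rot\<close> is applied to the normalised vector
    \<open>u + t *\<^sub>R w\<close>. Clearing the norm leaves a nonnegative quadratic in
    \<open>t\<close> whose linear coefficient is \<open>-2\<close> times the wanted inner
    product.\<close>
  have critical: "(X *v c) \<bullet> (A *v w) = 0"
    if c: "norm c = 1" and w: "transpose X *v w = 0" for c w
  proof -
    define u where "u = X *v c"
    have uu: "u \<bullet> u = 1" using c by (simp add: u_def dot_square_norm St_norm_vec[OF X])
    have uw: "u \<bullet> w = 0" using Xcw[OF w] by (simp add: u_def)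
    have Auw: "w \<bullet> (A *v u) = u \<bullet> (A *v w)"
      by (metis A symmetric_matrix_inner inner_commute)
    have "- 2 * (u \<bullet> (A *v w)) = 0"
    proof (rule quadratic_nonneg_linear_coeff_zero)
      fix t :: real
      define z where "z = u + t *\<^sub>R w"
      have zz: "(norm z)\<^sup>2 = 1 + t\<^sup>2 * (w \<bullet> w)"
        unfolding power2_norm_eq_inner
        by (simp add: z_def inner_add_left inner_add_right uu uw inner_commute[of w u]
            power2_eq_square)
      then have "(norm z)\<^sup>2 \<ge> 1" by simp
      then have nz: "norm z \<noteq> 0" by auto
      have "q (z /\<^sub>R norm z) \<le> q u"
      proof (unfold u_def, rule rot[OF c w])
        show "norm (z /\<^sub>R norm z) = 1" using nz by simp
        show "z /\<^sub>R norm z = inverse (norm z) *\<^sub>R (X *v c) + (t / norm z) *\<^sub>R w"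
          by (simp add: z_def u_def scaleR_add_right divide_inverse mult.commute)
      qed
      moreover have "q (z /\<^sub>R norm z) = q z / (norm z)\<^sup>2"
        by (simp add: q_def matrix_vector_mult_scaleR power2_eq_square divide_inverse)
      ultimately have "q z \<le> q u * (norm z)\<^sup>2"
        using nz by (simp add: divide_le_eq split: if_splits)
      moreover have "q z = q u + 2 * t * (u \<bullet> (A *v w)) + t\<^sup>2 * q w"
        by (simp add: z_def q_def matrix_vector_right_distrib matrix_vector_mult_scaleR
            inner_add_left inner_add_right Auw power2_eq_square algebra_simps)
      ultimately show "0 \<le> t * (- 2 * (u \<bullet> (A *v w))) + t\<^sup>2 * (q u * (w \<bullet> w) - q w)"
        by (simp add: zz algebra_simps)
    qed
    then show ?thesis by (simp add: u_def)
  qed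
  have XXA: "X *v (transpose X *v (A *v (X *v c))) = A *v (X *v c)" if c: "norm c = 1" for c
  proof -
    define u where "u = X *v c"
    \<comment> \<open>The component of \<open>A *v u\<close> orthogonal to the range of
      \<open>X\<close>; \<open>critical\<close> in this very direction makes it zero.\<close>
    define w where "w = A *v u - X *v (transpose X *v (A *v u))"
    have Xw: "transpose X *v w = 0"
      using X by (simp add: w_def matrix_vector_mult_diff_distrib matrix_vector_mul_assoc St_iff
          matrix_mul_assoc)
    have "w \<bullet> (A *v u) = 0" using critical[OF c Xw] A unfolding u_def by (metis symmetric_matrix_inner inner_commute)
    moreover have "w \<bullet> (X *v (transpose X *v (A *v u))) = 0"
      by (subst inner_matrix_vector_mult) (simp add: Xw)
    ultimately have "w \<bullet> w = 0" by (subst (2) w_def) (simp add: inner_diff_right)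
    then show ?thesis by (simp add: w_def u_def)
  qed
  have "(A ** X) $ i $ j = (X ** \<Omega>) $ i $ j" for i j
    unfolding matrix_entry_inner[of "A ** X"] matrix_entry_inner[of "X ** \<Omega>"]
    by (simp only: \<Omega>_def matrix_vector_mul_assoc[symmetric] XXA[OF norm_axis_1])
  then show AX: "A ** X = X ** \<Omega>" by (simp add: vec_eq_iff)
  obtain C B where C: "orthonormal C" "card C = CARD('k)" and B: "(*v) X ` C \<subseteq> B" "eigenset A B" "card B = CARD('n)"
    and m: "mset (eigvals \<Omega>) = image_mset q (mset_set ((*v) X ` C))"
    and mB: "mset (eigvals A) = mset (eigvals \<Omega>) + image_mset q (mset_set (B - (*v) X ` C))"
    by (rule invariant_subspace_eigenset[OF A X AX, folded q_def])
  have onB: "orthonormal B" using B by (simp add: eigenset_def)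
  have fin: "finite B" "finite ((*v) X ` C)" using orthonormal_finite onB C by blast+
  \<comment> \<open>The full exchange: an eigenvector \<open>b\<close> outside the image of
    \<open>C\<close> is orthogonal to the range of \<open>X\<close>, so \<open>rot\<close> applies
    with coefficients 0 and 1.\<close>
  have le: "q b \<le> q (X *v c)" if "c \<in> C" "b \<in> B - (*v) X ` C" for c b
  proof (rule rot)
    have "d \<bullet> (transpose X *v b) = 0" if "d \<in> C" for d
    proof -
      have "X *v d \<in> B" "b \<in> B" "X *v d \<noteq> b"
        using that B(1) \<open>b \<in> B - (*v) X ` C\<close> by auto
      then have "(X *v d) \<bullet> b = 0" by (simp add: orthonormal_inner[OF onB])
      then show ?thesis by (simp add: inner_matrix_vector_mult)
    qed
    then have "(transpose X *v b) \<bullet> (transpose X *v b) = 0"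
      using orthonormal_parseval[OF C(1), of "transpose X *v b" "transpose X *v b"] C(2) by simp
    then show "transpose X *v b = 0" by simp
    show "norm b = 1" "norm c = 1" using onB C that by (auto simp: orthonormal_def)
    show "b = 0 *\<^sub>R (X *v c) + 1 *\<^sub>R b" by simp
  qed
  have "set (eigvals \<Omega>) = q ` (*v) X ` C"
    using fin by (simp add: set_mset_mset[symmetric] m del: set_mset_mset)
  moreover have "symmetric_matrix \<Omega>" unfolding \<Omega>_def by (rule symmetric_congruence[OF A])
  ultimately show "eigvals \<Omega> = take CARD('k) (eigvals A)"
    using sorted_desc_eq_take[OF sorted_eigvals sorted_eigvals mB] le fin length_eigvals[of \<Omega>]
    by auto
qed

subsection \<open>Canonical angles, residuals and the eigenvalue gap\<close>

lemma norm_transpose_matrix: "norm (transpose M) = norm (M :: real^'m^'n)"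
  unfolding norm_matrix_Frobenius by (subst sum.swap) (simp add: transpose_def)

lemma inner_matrix_trace: "A \<bullet> B = trace (transpose A ** B)" for A B :: "real^'m^'n"
  unfolding inner_vec_def trace_def
  by (subst sum.swap) (simp add: matrix_matrix_mult_def transpose_def)

lemma inner_matrix_mult: "M \<bullet> (P ** N) = (transpose P ** M) \<bullet> N"
  for M :: "real^'m^'n" and P :: "real^'k^'n"
  by (simp add: inner_matrix_trace matrix_transpose_mul matrix_mul_assoc)

lemma St_inner_mult: "P \<in> St \<Longrightarrow> (P ** M) \<bullet> (P ** N) = M \<bullet> N"
  for M :: "real^'m^'k" and P :: "real^'k^'n"
  by (simp add: inner_matrix_mult matrix_mul_assoc St_iff)

lemma St_norm_mult: "P \<in> St \<Longrightarrow> norm (P ** M) = norm M"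
  for M :: "real^'m^'k" and P :: "real^'k^'n"
  by (simp add: norm_eq_sqrt_inner St_inner_mult)

text \<open>Pythagoras for the orthogonal projection \<open>P ** transpose P\<close>.\<close>

lemma St_norm_residual:
  fixes M :: "real^'m^'n" and P :: "real^'k^'n"
  assumes "P \<in> St"
  shows "(norm (M - P ** (transpose P ** M)))\<^sup>2 = (norm M)\<^sup>2 - (norm (transpose P ** M))\<^sup>2"
proof -
  define N where "N = transpose P ** M"
  have "M \<bullet> (P ** N) = N \<bullet> N" unfolding N_def by (rule inner_matrix_mult)
  then show ?thesis
    unfolding N_def[symmetric] power2_norm_eq_inner
    by (simp add: inner_diff_left inner_diff_right St_inner_mult[OF assms]
        inner_commute[of "P ** N" M])
qed

lemma St_norm_residual_le:
  fixes M :: "real^'m^'n" and P :: "real^'k^'n"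
  assumes "P \<in> St"
  shows "norm (M - P ** (transpose P ** M)) \<le> norm M"
  by (rule power2_le_imp_le) (simp_all add: St_norm_residual[OF assms])

lemma St_norm_transpose_mult_le:
  fixes M :: "real^'m^'n" and P :: "real^'k^'n"
  assumes "P \<in> St"
  shows "norm (transpose P ** M) \<le> norm M"
proof (rule power2_le_imp_le)
  show "(norm (transpose P ** M))\<^sup>2 \<le> (norm M)\<^sup>2"
    using St_norm_residual[OF assms, of M] zero_le_power2[of "norm (M - P ** (transpose P ** M))"]
    by linarith
qed simp

lemma St_norm_sq: "P \<in> St \<Longrightarrow> (norm P)\<^sup>2 = CARD('k)" for P :: "real^'k^'n"
  by (simp add: trace_transpose_mult_self[symmetric] St_iff trace_I)

lemma norm_matrix_mult_le:
  fixes A :: "real^'m^'n" and B :: "real^'k^'m"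
  shows "norm (A ** B) \<le> norm A * norm B"
proof (rule power2_le_imp_le)
  have rows: "(norm M)\<^sup>2 = (\<Sum>i\<in>UNIV. (norm (M $ i))\<^sup>2)" for M :: "real^'a^'b"
    by (simp add: norm_vec_def L2_set_def sum_nonneg)
  have cols: "(norm B)\<^sup>2 = (\<Sum>j\<in>UNIV. (norm (column j B))\<^sup>2)"
    unfolding norm_transpose_matrix[of B, symmetric] rows by (simp add: transpose_def column_def)
  have "(norm (A ** B))\<^sup>2 = (\<Sum>i\<in>UNIV. \<Sum>j\<in>UNIV. (A $ i \<bullet> column j B)\<^sup>2)"
    by (simp add: norm_matrix_Frobenius sum_nonneg matrix_matrix_mult_def inner_vec_def column_def)
  also have "\<dots> \<le> (\<Sum>i\<in>UNIV. \<Sum>j\<in>UNIV. (norm (A $ i))\<^sup>2 * (norm (column j B))\<^sup>2)"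
    by (intro sum_mono) (simp add: Cauchy_Schwarz_ineq power2_norm_eq_inner)
  also have "\<dots> = (norm A * norm B)\<^sup>2"
    by (simp add: rows[of A] cols power_mult_distrib sum_product)
  finally show "(norm (A ** B))\<^sup>2 \<le> (norm A * norm B)\<^sup>2" .
qed simp

text \<open>The squared sine of the arccosine of a singular value s is 1 - s^2, and the squared
  singular values sum to the squared Frobenius norm. From here on the angles enter only through this
  expression.\<close>

lemma norm_sin_Theta_sq:
  fixes X Y :: "real^'k^'n"
  assumes "X \<in> St" "Y \<in> St"
  shows "(norm_sin_Theta X Y)\<^sup>2 = CARD('k) - (norm (transpose X ** Y))\<^sup>2"
proof -
  define M where "M = transpose X ** Y"
  define G where "G = transpose M ** M"
  have "symmetric_matrix G" by (simp add: G_def symmetric_matrix_def matrix_transpose_mul)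
  moreover have "eigenset G {}" by (simp add: eigenset_def orthonormal_def)
  ultimately obtain B where B: "eigenset G B" "card B = CARD('k)"
    using eigenset_extend by blast
  then have on: "orthonormal B" by (simp add: eigenset_def)
  have bG: "b \<bullet> (G *v b) = (norm (M *v b))\<^sup>2" for b
    by (simp add: G_def matrix_vector_mul_assoc[symmetric] inner_matrix_vector_mult
        power2_norm_eq_inner)
  \<comment> \<open>Singular values must be at most 1 for \<open>arccos\<close> to invert
    \<open>cos\<close>; this holds because neither \<open>Y\<close> nor \<open>transpose X\<close>
    increases the norm.\<close>
  have term_eq: "(sin (arccos (sqrt (b \<bullet> (G *v b)))))\<^sup>2 = 1 - (norm (M *v b))\<^sup>2" if "b \<in> B" for b
  proof -
    have "norm (M *v b) \<le> norm (Y *v b)"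
      unfolding M_def matrix_vector_mul_assoc[symmetric] by (rule St_norm_transpose_le[OF assms(1)])
    also have "\<dots> = 1" using St_norm_vec[OF assms(2)] on that by (simp add: orthonormal_def)
    finally have "norm (M *v b) \<le> 1" .
    then have "cos (arccos (norm (M *v b))) = norm (M *v b)"
      by (intro cos_arccos) (auto intro: order_trans[of _ 0])
    then show ?thesis by (simp add: bG sin_squared_eq)
  qed
  have "(\<Sum>\<theta>\<leftarrow>canonical_angles X Y. (sin \<theta>)\<^sup>2)
      = (\<Sum>e\<leftarrow>eigvals G. (sin (arccos (sqrt e)))\<^sup>2)"
    by (simp add: canonical_angles_def singvals_def comp_def G_def M_def)
  also have "\<dots> = (\<Sum>b\<in>B. 1 - (norm (M *v b))\<^sup>2)"
    unfolding sum_list_eigvals[OF B] using term_eq by (intro sum.cong) auto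
  also have "\<dots> = CARD('k) - (norm M)\<^sup>2"
    by (simp add: sum_subtractf B(2) norm_matrix_orthonormal[OF on B(2)])
  finally have *: "(\<Sum>\<theta>\<leftarrow>canonical_angles X Y. (sin \<theta>)\<^sup>2) = CARD('k) - (norm M)\<^sup>2" .
  have "0 \<le> (\<Sum>\<theta>\<leftarrow>canonical_angles X Y. (sin \<theta>)\<^sup>2)" by (intro sum_list_nonneg) auto
  with * show ?thesis by (simp add: norm_sin_Theta_def M_def)
qed

lemma matrix_diff_ldistrib: "A ** (B - C) = A ** B - A ** C" for A :: "real^'m^'n"
  by (simp add: vec_eq_iff matrix_matrix_mult_def sum_subtractf right_diff_distrib)

lemma matrix_diff_rdistrib: "(A - B) ** C = A ** C - B ** C" for A :: "real^'m^'n"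
  by (simp add: vec_eq_iff matrix_matrix_mult_def sum_subtractf left_diff_distrib)

text \<open>\<open>A ** Y\<close> is split into its projection onto the invariant range of
  \<open>X\<close> and \<open>A\<close> applied to the rest of \<open>Y\<close>. After projecting
  away from the range of \<open>Y\<close>, each part is at most \<open>norm A\<close> times the norm
  of the sines; the factor 4 is the square of these two contributions.\<close>

lemma residual_bound:
  fixes A :: "real^'n^'n" and X Y :: "real^'k^'n"
  assumes A: "symmetric_matrix A" and X: "X \<in> St" "A ** X = X ** \<Omega>" and Y: "Y \<in> St"
  shows "(norm (A ** Y - Y ** (transpose Y ** A ** Y)))\<^sup>2
    \<le> 4 * (norm A)\<^sup>2 * (CARD('k) - (norm (transpose X ** Y))\<^sup>2)"
proof -
  define D where "D = sqrt (CARD('k) - (norm (transpose X ** Y))\<^sup>2)"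
  define R where "R M = M - Y ** (transpose Y ** M)" for M :: "real^'k^'n"
  define Z where "Z = Y - X ** (transpose X ** Y)"
  have tr: "norm (transpose Y ** X) = norm (transpose X ** Y)"
    by (metis matrix_transpose_mul norm_transpose_matrix transpose_transpose)
  \<comment> \<open>Projecting \<open>Y\<close> onto the range of \<open>X\<close> and
    \<open>X\<close> onto the range of \<open>Y\<close> leaves residuals of equal norm.\<close>
  have D2: "(norm Z)\<^sup>2 = CARD('k) - (norm (transpose X ** Y))\<^sup>2"
    "(norm (R X))\<^sup>2 = CARD('k) - (norm (transpose X ** Y))\<^sup>2"
    using St_norm_residual[OF X(1), of Y] St_norm_residual[OF Y, of X]
    by (simp_all add: Z_def R_def St_norm_sq X Y tr)
  then have D: "norm Z = D" "norm (R X) = D" "0 \<le> D" "D\<^sup>2 = CARD('k) - (norm (transpose X ** Y))\<^sup>2"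
    by (metis D_def norm_ge_zero real_sqrt_abs abs_of_nonneg)+
  have XA: "transpose X ** A = transpose \<Omega> ** transpose X"
    using A X(2) by (metis matrix_transpose_mul symmetric_matrix_def)
  have Om: "\<Omega> = transpose X ** A ** X"
    using X by (simp add: matrix_mul_assoc[symmetric]) (simp add: matrix_mul_assoc St_iff)
  then have Osym: "transpose \<Omega> = \<Omega>"
    using symmetric_congruence[OF A, of X] by (simp add: symmetric_matrix_def)
  \<comment> \<open>A symmetric matrix commutes with the orthogonal projection onto its invariant
    subspace.\<close>
  have comm: "X ** (transpose X ** (A ** Y)) = A ** (X ** (transpose X ** Y))"
    using X(2) XA Osym by (simp add: matrix_mul_assoc)
  have split: "A ** Y = X ** (transpose X ** (A ** Y)) + A ** Z"
    by (simp add: comm Z_def matrix_diff_ldistrib)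
  have "R (A ** Y) = R X ** (transpose X ** (A ** Y)) + R (A ** Z)"
    by (subst split) (simp add: R_def matrix_add_ldistrib matrix_mul_assoc
       matrix_diff_ldistrib matrix_diff_rdistrib)
  then have "norm (R (A ** Y)) \<le> norm (R X ** (transpose X ** (A ** Y))) + norm (R (A ** Z))"
    by (metis norm_triangle_ineq)
  also have "norm (R X ** (transpose X ** (A ** Y))) \<le> D * norm A"
  proof -
    have "norm (transpose X ** (A ** Y)) \<le> norm (A ** Y)"
      by (rule St_norm_transpose_mult_le[OF X(1)])
    also have "\<dots> = norm (transpose Y ** A)"
      using A by (metis matrix_transpose_mul norm_transpose_matrix symmetric_matrix_def)
    also have "\<dots> \<le> norm A" by (rule St_norm_transpose_mult_le[OF Y])
    finally have "norm (R X) * norm (transpose X ** (A ** Y)) \<le> D * norm A"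
      using D by (simp add: mult_left_mono)
    then show ?thesis using norm_matrix_mult_le order_trans by blast
  qed
  also have "norm (R (A ** Z)) \<le> norm A * D"
    unfolding R_def D(1)[symmetric]
    using St_norm_residual_le[OF Y] norm_matrix_mult_le order_trans by blast
  finally have "norm (R (A ** Y)) \<le> 2 * norm A * D" by (simp add: mult.commute mult.left_commute)
  then have "(norm (R (A ** Y)))\<^sup>2 \<le> (2 * norm A * D)\<^sup>2"
    by (rule power_mono) simp
  then show ?thesis
    by (simp add: R_def D(4) power_mult_distrib matrix_mul_assoc)
qed

lemma top_eigenbasis_gap:
  fixes A :: "real^'n^'n" and X Y :: "real^'k^'n"
  defines "D \<equiv> CARD('k) - (norm (transpose X ** Y))\<^sup>2"
    and "gap \<equiv> eigval A CARD('k) - eigval A (CARD('k) + 1)"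
  assumes kn: "CARD('k) \<le> CARD('n)"
    and A: "symmetric_matrix A" and top: "top_eigenbasis A X" and Y: "Y \<in> St"
  shows "0 \<le> D" "0 \<le> gap * D"
    "gap * D \<le> trace (transpose X ** A ** X) - trace (transpose Y ** A ** Y)"
proof -
  obtain \<Omega> where X: "X \<in> St" and AX: "A ** X = X ** \<Omega>"
    and ev: "eigvals \<Omega> = take CARD('k) (eigvals A)"
    using top by (auto simp: top_eigenbasis_def)
  define q where "q = (\<lambda>x. x \<bullet> (A *v x))"
  define w where "w x = (norm (transpose Y *v x))\<^sup>2" for x
  obtain C B where onC: "orthonormal C" and cardC: "card C = CARD('k)"
    and XCB: "(*v) X ` C \<subseteq> B" and eB: "eigenset A B" and cardB: "card B = CARD('n)"
    and mX: "mset (eigvals \<Omega>) = image_mset q (mset_set ((*v) X ` C))"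
    and mBX: "mset (eigvals A) = mset (eigvals \<Omega>) + image_mset q (mset_set (B - (*v) X ` C))"
    by (rule invariant_subspace_eigenset[OF A X AX, folded q_def])
  define S where "S = (*v) X ` C"
  note B = XCB[folded S_def] eB cardB and C = onC cardC
    and m = mX[folded S_def] and mB = mBX[folded S_def]
  have onS: "orthonormal S" and inj: "inj_on ((*v) X) C"
    unfolding S_def using St_image_orthonormal[OF X onC] by auto
  have onB: "orthonormal B" using B by (simp add: eigenset_def)
  have finS: "finite S" and finB: "finite B" using orthonormal_finite onS onB by blast+
  have cardS: "card S = CARD('k)" using C card_image[OF inj] by (simp add: S_def)
  have trX: "trace (transpose X ** A ** X) = (\<Sum>s\<in>S. q s)"
    unfolding trace_congruence[OF onC C(2)] S_def by (simp add: sum.reindex[OF inj] q_def)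
  have w0: "0 \<le> w x" for x by (simp add: w_def)
  have w1: "w b \<le> 1" if "b \<in> B" for b
    using St_norm_transpose_le[OF Y, of b] onB that
    by (simp add: w_def orthonormal_def abs_square_le_1)
  have "(norm (transpose Y))\<^sup>2 = (\<Sum>b\<in>B. w b)"
    unfolding w_def by (rule norm_matrix_orthonormal[OF onB B(3)])
  then have sumB: "(\<Sum>b\<in>B. w b) = CARD('k)"
    by (simp add: norm_transpose_matrix St_norm_sq[OF Y])
  have "norm (transpose Y ** X) = norm (transpose X ** Y)"
    by (metis matrix_transpose_mul norm_transpose_matrix transpose_transpose)
  then have sumS: "(\<Sum>s\<in>S. w s) = (norm (transpose X ** Y))\<^sup>2"
    unfolding S_def using norm_matrix_orthonormal[OF onC C(2), of "transpose Y ** X"]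
    by (simp add: sum.reindex[OF inj] w_def matrix_vector_mul_assoc)
  \<comment> \<open>\<open>D\<close> is both the total weight missing on \<open>S\<close> and, by
    \<open>D_B\<close> below, the total weight placed on \<open>B - S\<close>, because all weights
    sum to \<open>k\<close>. The trace difference is thus a transfer of weight \<open>D\<close>
    across the gap.\<close>
  have D_S: "D = (\<Sum>s\<in>S. 1 - w s)" by (simp add: D_def sum_subtractf sumS cardS)
  have BS: "(\<Sum>b\<in>B. g b) = (\<Sum>s\<in>S. g s) + (\<Sum>b\<in>B - S. g b)" for g :: "_ \<Rightarrow> real"
    using sum.subset_diff[OF B(1) finB, of g] by simp
  have D_B: "D = (\<Sum>b\<in>B - S. w b)" using BS[of w] by (simp add: D_def sumB sumS)
  show D0: "0 \<le> D" unfolding D_B by (simp add: sum_nonneg w0)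
  have "trace (transpose Y ** A ** Y) = trace (Y ** transpose Y ** A)"
    using trace_mul_sym[of "transpose Y ** A" Y] trace_mul_sym[of A "Y ** transpose Y"]
    by (metis matrix_mul_assoc trace_mul_sym)
  also have "\<dots> = (\<Sum>b\<in>B. q b * w b)"
    unfolding trace_orthonormal[OF onB B(3)]
  proof (rule sum.cong)
    fix b assume "b \<in> B"
    have "b \<bullet> (Y ** transpose Y ** A *v b) = (transpose Y *v b) \<bullet> (transpose Y *v (A *v b))"
      by (simp add: matrix_vector_mul_assoc[symmetric] inner_matrix_vector_mult[of _ Y])
    also have "A *v b = q b *\<^sub>R b" using B(2) \<open>b \<in> B\<close> by (simp add: eigenset_def q_def)
    finally show "b \<bullet> (Y ** transpose Y ** A *v b) = q b * w b"
      by (simp add: matrix_vector_mult_scaleR w_def power2_norm_eq_inner)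
  qed simp
  finally have diff: "trace (transpose X ** A ** X) - trace (transpose Y ** A ** Y)
      = (\<Sum>s\<in>S. q s * (1 - w s)) - (\<Sum>b\<in>B - S. q b * w b)"
    by (simp add: trX BS right_diff_distrib sum_subtractf)
  have len: "length (eigvals A) = CARD('n)" by (rule length_eigvals[OF A])
  have "0 \<le> gap * D \<and> gap * D \<le> (\<Sum>s\<in>S. q s * (1 - w s)) - (\<Sum>b\<in>B - S. q b * w b)"
  \<comment> \<open>For \<open>k = n\<close> the number \<open>gap\<close> contains the default
    value 0 of \<open>eigval\<close> and may have either sign, but \<open>B - S\<close> is empty and
    \<open>D\<close> vanishes.\<close>
  proof (cases "CARD('k) = CARD('n)")
    case True
    then have "S = B" using B(1,3) finB cardS by (simp add: card_subset_eq)
    then have "D = 0" using D_B by simp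
    then have "\<forall>s\<in>S. 1 - w s = 0"
      using D_S w1 \<open>S = B\<close> finS by (subst (asm) eq_commute) (simp add: sum_nonneg_eq_0_iff)
    with \<open>D = 0\<close> \<open>S = B\<close> show ?thesis by simp
  next
    case False
    let ?L = "eigvals A"
    have kL: "CARD('k) < length ?L" using False kn len by simp
    \<comment> \<open>\<open>eigval\<close> counts from 1 and lists from 0, so the indices drop by
      one.\<close>
    have gap: "gap = ?L ! (CARD('k) - 1) - ?L ! CARD('k)"
      using kL by (simp add: gap_def eigval_def Suc_leI)
    have dec: "?L ! j \<le> ?L ! i" if "i \<le> j" "j < length ?L" for i j
      using sorted_rev_nth_mono[OF sorted_eigvals that] .
    have big: "?L ! (CARD('k) - 1) \<le> q s" if "s \<in> S" for s
    proof -
      have "q s \<in># image_mset q (mset_set S)" using that finS by simp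
      then have "q s \<in> set (take CARD('k) ?L)" by (metis ev m set_mset_mset)
      then obtain i where "i < CARD('k)" "?L ! i = q s" using kL by (auto simp: in_set_conv_nth)
      then show ?thesis using dec[of i "CARD('k) - 1"] kL by simp
    qed
    have small: "q b \<le> ?L ! CARD('k)" if "b \<in> B - S" for b
    proof -
      \<comment> \<open>Cancelling the first \<open>k\<close> eigenvalues from two splittings of the
        spectrum identifies the values on \<open>B - S\<close> with the dropped tail.\<close>
      have "mset ?L = mset (take CARD('k) ?L) + image_mset q (mset_set (B - S))"
        using mB ev by simp
      moreover have "mset ?L = mset (take CARD('k) ?L) + mset (drop CARD('k) ?L)"
        by (metis append_take_drop_id mset_append)
      ultimately have "mset (drop CARD('k) ?L) = image_mset q (mset_set (B - S))" by simp
      moreover have "q b \<in># image_mset q (mset_set (B - S))" using that finB by simp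
      ultimately have "q b \<in> set (drop CARD('k) ?L)" by (metis set_mset_mset)
      then obtain i where "i < length ?L - CARD('k)" "?L ! (CARD('k) + i) = q b"
        using kL by (auto simp: in_set_conv_nth)
      then show ?thesis using dec[of "CARD('k)" "CARD('k) + i"] by simp
    qed
    have "0 \<le> gap" using dec[of "CARD('k) - 1" "CARD('k)"] kL by (simp add: gap)
    moreover have "?L ! (CARD('k) - 1) * D \<le> (\<Sum>s\<in>S. q s * (1 - w s))"
      unfolding D_S sum_distrib_left
      using big w1 B(1) by (intro sum_mono mult_right_mono) auto
    moreover have "(\<Sum>b\<in>B - S. q b * w b) \<le> ?L ! CARD('k) * D"
      unfolding D_B sum_distrib_left
      using small w0 by (intro sum_mono mult_right_mono) auto
    moreover have "0 \<le> gap * D" using \<open>0 \<le> gap\<close> D0 by (rule mult_nonneg_nonneg)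
    ultimately show ?thesis by (auto simp: gap left_diff_distrib)
  qed
  then show "0 \<le> gap * D"
    "gap * D \<le> trace (transpose X ** A ** X) - trace (transpose Y ** A ** Y)"
    by (simp_all add: diff)
qed

subsection \<open>The SCF iteration\<close>

lemma tendsto_matrix_mult [tendsto_intros]:
  fixes f :: "'a \<Rightarrow> real^'m^'n" and g :: "'a \<Rightarrow> real^'k^'m"
  assumes "(f \<longlongrightarrow> a) F" "(g \<longlongrightarrow> b) F"
  shows "((\<lambda>x. f x ** g x) \<longlongrightarrow> a ** b) F"
  unfolding matrix_matrix_mult_def
  by (intro tendsto_vec_lambda tendsto_sum tendsto_mult tendsto_vec_nth assms)

lemma tendsto_transpose [tendsto_intros]:
  fixes f :: "'a \<Rightarrow> real^'m^'n"
  assumes "(f \<longlongrightarrow> a) F"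
  shows "((\<lambda>x. transpose (f x)) \<longlongrightarrow> transpose a) F"
  unfolding transpose_def by (intro tendsto_vec_lambda tendsto_vec_nth assms)

lemma tendsto_trace [tendsto_intros]:
  fixes f :: "'a \<Rightarrow> real^'n^'n"
  assumes "(f \<longlongrightarrow> a) F"
  shows "((\<lambda>x. trace (f x)) \<longlongrightarrow> trace a) F"
  unfolding trace_def by (intro tendsto_sum tendsto_vec_nth assms)

lemma closed_St: "closed (St :: (real^'k^'n) set)"
proof -
  have "continuous_on UNIV (\<lambda>P :: real^'k^'n. transpose P ** P)"
    unfolding continuous_on_def by (intro ballI tendsto_intros)
  then show ?thesis
    using continuous_closed_vimage[of "{mat 1}" "\<lambda>P :: real^'k^'n. transpose P ** P"]
    by (simp add: St_def vimage_def continuous_on_eq_continuous_at)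
qed

lemma compact_St: "compact (St :: (real^'k^'n) set)"
proof -
  have "norm P = sqrt CARD('k)" if "P \<in> St" for P :: "real^'k^'n"
    using St_norm_sq[OF that] by (metis norm_ge_zero real_sqrt_unique)
  then have "bounded (St :: (real^'k^'n) set)"
    unfolding bounded_iff by (metis order_refl)
  then show ?thesis using closed_St compact_eq_bounded_closed by blast
qed

lemma St_subset_nbhd: "matrix_norm N \<Longrightarrow> \<delta> > 0 \<Longrightarrow> St \<subseteq> St_nbhd N \<delta>"
  unfolding matrix_norm_def by (auto simp: St_iff St_nbhd_def) metis

text \<open>An accumulation point is expressed as the limit of a subsequence. Continuity of
  \<open>H\<close> there, relative to \<open>St\<close>, is what carries the trace inequalities to
  the limit. \<open>Suc i\<close> makes both series start at index 1.\<close>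

theorem theorem6p4:
  fixes f :: "real^'k^'n \<Rightarrow> real"
    and H :: "real^'k^'n \<Rightarrow> real^'n^'n"
    and PP :: "(real^'k^'n) set"
    and N :: "real^'k^'k \<Rightarrow> real"
    and \<delta> \<omega> :: real
    and P :: "nat \<Rightarrow> real^'k^'n"
  assumes "CARD('k) \<le> CARD('n)"
    and "matrix_norm N" and "\<delta> > 0"
    and "f differentiable_on St_nbhd N \<delta>"
    and "\<forall>X\<in>St. symmetric_matrix (H X)"
    and "PP \<subseteq> St"
    and "NEPv_Ansatz \<omega> f H PP"
    and "NEPvSCF \<omega> f H PP P"
  shows "(incseq (\<lambda>i. f (P i)) \<and> convergent (\<lambda>i. f (P i)))
    \<and> ((\<forall>X\<in>PP. (\<forall>Y\<in>St. f Y \<le> f X) \<longrightarrow> NEPv_condition H X) \<and>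
       (\<forall>Pstar r. strict_mono r \<and> (P \<circ> r) \<longlonglongrightarrow> Pstar \<and>
          continuous (at Pstar within St) H \<longrightarrow>
            NEPv_condition H Pstar \<and>
            (\<forall>M :: real^'k^'n \<Rightarrow> real^'k^'k.
               (\<forall>X\<in>St. H X ** X - partial_matrix f X = X ** M X) \<and>
               symmetric_matrix (M Pstar) \<longrightarrow> KKT_point f Pstar)))
    \<and> (let d = (\<lambda>i. eigval (H (P i)) CARD('k) - eigval (H (P i)) (CARD('k) + 1));
           \<Lambda> = (\<lambda>i. transpose (P i) ** H (P i) ** P i)
       in summable (\<lambda>i. d (Suc i) * (norm_sin_Theta (P (Suc i + 1)) (P (Suc i)))\<^sup>2) \<and>
          summable (\<lambda>i. d (Suc i) *
            ((norm (H (P (Suc i)) ** P (Suc i) - P (Suc i) ** \<Lambda> (Suc i)))\<^sup>2 /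
             (norm (H (P (Suc i))))\<^sup>2)))"
proof -
  have sym: "symmetric_matrix (H X)" if "X \<in> St" for X using assms(5) that by blast
  have PPi: "P i \<in> PP" for i using assms(8) by (cases i) (auto simp: NEPvSCF_def)
  then have Pi: "P i \<in> St" for i using assms(6) by blast
  have \<omega>: "\<omega> > 0" using assms(7) by (simp add: NEPv_Ansatz_def)
  define tr where "tr X Y = trace (transpose Y ** H X ** Y)" 
    for X Y :: "real^'k^'n"
  have maxNEPv: "NEPv_condition H X" if "X \<in> St" "\<And>Y. Y \<in> St \<Longrightarrow> tr X Y \<le> tr X X" for X
    using trace_maximizer_NEPv[OF sym that(1), OF that(1)] that
    by (simp add: NEPv_condition_def tr_def Let_def)
  define D where "D i = (norm_sin_Theta (P (i + 1)) (P i))\<^sup>2" for i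
  define d where "d i = eigval (H (P i)) CARD('k) - eigval (H (P i)) (CARD('k) + 1)" for i
  define res where "res i = norm (H (P i) ** P i - P i ** (transpose (P i) ** H (P i) ** P i))" for i
  \<comment> \<open>Everything one iteration contributes: the gain of \<open>f\<close> bounds the
    weighted sines for (c) and the trace excess of every competitor \<open>Y\<close> for
    (b).\<close>
  have step: "0 \<le> D i \<and> 0 \<le> d i * D i \<and> d i * D i \<le> (f (P (Suc i)) - f (P i)) / \<omega> \<and>
      (res i)\<^sup>2 \<le> 4 * (norm (H (P i)))\<^sup>2 * D i \<and>
      (\<forall>Y\<in>St. tr (P i) Y - tr (P i) (P i) \<le> (f (P (Suc i)) - f (P i)) / \<omega>)" for i
  proof -
    obtain X Q where Q: "Q \<in> (St :: (real^'k^'k) set)" and top: "top_eigenbasis (H (P i)) X"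
      and Pn: "P (Suc i) = X ** Q"
      and inc: "f (P (Suc i)) \<ge> f (P i) + \<omega> * (tr (P i) X - tr (P i) (P i))"
      using assms(8) unfolding NEPvSCF_def tr_def by blast
    have X: "X \<in> St" using top by (simp add: top_eigenbasis_def)
    note gap = top_eigenbasis_gap[OF assms(1) sym[OF Pi] top]
    have inc': "tr (P i) X - tr (P i) (P i) \<le> (f (P (Suc i)) - f (P i)) / \<omega>"
      using inc \<omega> by (simp add: field_simps)
    \<comment> \<open>The alignment factor \<open>Q\<close> is square and orthogonal, so it does not
      affect the Frobenius norm that determines the angles.\<close>
    have QQ: "transpose Q \<in> St"
      using Q by (simp add: St_iff matrix_left_right_inverse)
    have "norm (transpose (P (i + 1)) ** P i) = norm (transpose X ** P i)"
      using St_norm_mult[OF QQ, of "transpose X ** P i"]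
      by (simp add: Pn matrix_transpose_mul matrix_mul_assoc)
    then have D: "D i = CARD('k) - (norm (transpose X ** P i))\<^sup>2"
      by (simp add: D_def norm_sin_Theta_sq[OF Pi Pi])
    \<comment> \<open>Ky Fan: the trace difference dominates \<open>gap * D\<close>, which is
      nonnegative.\<close>
    have "tr (P i) Y \<le> tr (P i) X" if "Y \<in> St" for Y
      using gap(2,3)[OF that] by (simp add: tr_def)
    moreover obtain \<Omega> where "H (P i) ** X = X ** \<Omega>" using top by (auto simp: top_eigenbasis_def)
    then have "(res i)\<^sup>2 \<le> 4 * (norm (H (P i)))\<^sup>2 * D i"
      unfolding D res_def by (rule residual_bound[OF sym[OF Pi] X _ Pi])
    ultimately show ?thesis
      using gap[OF Pi[of i]] inc' by (fastforce simp: D d_def tr_def)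
  qed
  have inc: "incseq (\<lambda>i. f (P i))"
  proof (rule incseq_SucI)
    fix i
    have "0 \<le> (f (P (Suc i)) - f (P i)) / \<omega>" using step[of i] by linarith
    then show "f (P i) \<le> f (P (Suc i))" using \<omega> by (simp add: zero_le_divide_iff)
  qed
  have "continuous_on St f"
    using differentiable_imp_continuous_on[OF assms(4)] continuous_on_subset
      St_subset_nbhd[OF assms(2,3)] by blast
  then have "bdd_above (f ` St)"
    by (intro bounded_imp_bdd_above compact_imp_bounded compact_continuous_image compact_St)
  then obtain U where "\<And>X. X \<in> St \<Longrightarrow> f X \<le> U" by (auto simp: bdd_above_def)
  then obtain L where L: "(\<lambda>i. f (P i)) \<longlonglongrightarrow> L"
    using incseq_convergent[OF inc] Pi by metis
  \<comment> \<open>The rescaled gain of \<open>f\<close>: it telescopes to a summable sequence,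
    which serves as majorant in (c) and as null sequence in (b).\<close>
  define g where "g i = (f (P (Suc i)) - f (P i)) / \<omega>" for i
  have sumg: "summable g"
    unfolding g_def using telescope_summable[OF L] by (rule summable_divide)
  have glim: "g \<longlonglongrightarrow> 0" using summable_LIMSEQ_zero[OF sumg] .
  \<comment> \<open>The Ansatz with \<eta> equal to the exact trace excess of \<open>Y\<close> would
    improve \<open>f\<close> if that excess were positive.\<close>
  have global: "NEPv_condition H X" if X: "X \<in> PP" and opt: "\<forall>Y\<in>St. f Y \<le> f X" for X
  proof (rule maxNEPv)
    show "X \<in> St" using X assms(6) by blast
    fix Y :: "real^'k^'n" assume "Y \<in> St"
    then obtain Q where "Y ** Q \<in> PP" "f (Y ** Q) \<ge> f X + \<omega> * (tr X Y - tr X X)"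
      using assms(7) X unfolding NEPv_Ansatz_def tr_def
      by (metis add.commute diff_add_cancel order_refl)
    then have "\<omega> * (tr X Y - tr X X) \<le> 0" using opt assms(6) by fastforce
    then show "tr X Y \<le> tr X X" using \<omega> by (simp add: mult_le_0_iff)
  qed
  have limit: "NEPv_condition H Z"
    if r: "strict_mono r" and lim: "(P \<circ> r) \<longlonglongrightarrow> Z" and cont: "continuous (at Z within St) H" for Z r
  proof (rule maxNEPv)
    show Z: "Z \<in> St" using closed_sequentially[OF closed_St _ lim] Pi by simp
    have Hlim: "(\<lambda>i. H (P (r i))) \<longlonglongrightarrow> H Z"
      using cont lim Pi unfolding continuous_within_sequentially by (auto simp: comp_def)
    have Plim: "(\<lambda>i. P (r i)) \<longlonglongrightarrow> Z" using lim by (simp add: comp_def)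
    fix Y :: "real^'k^'n" assume Y: "Y \<in> St"
    \<comment> \<open>For fixed \<open>Y\<close> the trace excess converges along the subsequence,
      while its upper bound \<open>g (r i)\<close> tends to 0.\<close>
    have "(\<lambda>i. tr (P (r i)) Y - tr (P (r i)) (P (r i))) \<longlonglongrightarrow> tr Z Y - tr Z Z"
      unfolding tr_def by (intro tendsto_intros Hlim Plim)
    moreover have "(\<lambda>i. g (r i)) \<longlonglongrightarrow> 0"
      using LIMSEQ_subseq_LIMSEQ[OF glim r] by (simp add: comp_def)
    moreover have "tr (P (r i)) Y - tr (P (r i)) (P (r i)) \<le> g (r i)" for i
      using step[of "r i"] Y by (simp add: g_def)
    ultimately have "tr Z Y - tr Z Z \<le> 0" by (blast intro: LIMSEQ_le)
    then show "tr Z Y \<le> tr Z Z" by simp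
  qed
  have kkt: "KKT_point f Z"
    if Z: "Z \<in> St" and nepv: "NEPv_condition H Z"
      and M: "\<forall>X\<in>St. H X ** X - partial_matrix f X = X ** M X" "symmetric_matrix (M Z)"
    for Z and M :: "real^'k^'n \<Rightarrow> real^'k^'k"
  proof -
    define \<Omega> where "\<Omega> = transpose Z ** H Z ** Z"
    have "H Z ** Z = Z ** \<Omega>" using nepv by (simp add: NEPv_condition_def Let_def \<Omega>_def)
    moreover have "H Z ** Z - partial_matrix f Z = Z ** M Z" using M(1) Z by blast
    \<comment> \<open>Subtracting the two expressions for \<open>H Z ** Z\<close> exhibits the
      multiplier \<open>\<Omega> - M Z\<close>.\<close>
    ultimately have "partial_matrix f Z = Z ** (\<Omega> - M Z)"
      by (simp add: matrix_diff_ldistrib algebra_simps)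
    moreover have "symmetric_matrix (\<Omega> - M Z)"
      using symmetric_congruence[OF sym[OF Z], of Z] M(2)
      by (simp add: symmetric_matrix_def \<Omega>_def vec_eq_iff transpose_def)
    ultimately show ?thesis using Z by (auto simp: KKT_point_def)
  qed
  have limit_St: "Z \<in> St" if "(P \<circ> r) \<longlonglongrightarrow> Z" for Z r
    using closed_sequentially[OF closed_St _ that] Pi by simp
  have sum1: "summable (\<lambda>i. d (Suc i) * D (Suc i))"
  proof (rule summable_comparison_test)
    show "summable (\<lambda>i. g (Suc i))" using sumg by (simp add: summable_Suc_iff)
    show "\<exists>n0. \<forall>n\<ge>n0. norm (d (Suc n) * D (Suc n)) \<le> g (Suc n)"
      using step by (auto simp: g_def)
  qed
  have frac: "0 \<le> d i * ((res i)\<^sup>2 / (norm (H (P i)))\<^sup>2)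
      \<and> d i * ((res i)\<^sup>2 / (norm (H (P i)))\<^sup>2) \<le> 4 * (d i * D i)" for i
  proof -
    \<comment> \<open>If \<open>H (P i) = 0\<close>, the quotient is 0 by the convention for
      division by zero, and \<open>D i\<close> is nonnegative.\<close>
    have le: "(res i)\<^sup>2 / (norm (H (P i)))\<^sup>2 \<le> 4 * D i"
      using step[of i] by (cases "H (P i) = 0") (auto simp: divide_le_eq algebra_simps)
    show ?thesis
    proof (cases "d i \<ge> 0")
      case True
      then show ?thesis using mult_left_mono[OF le True] by simp
    next
      \<comment> \<open>A negative \<open>d i\<close> can arise only from the default eigenvalue at
        \<open>k = n\<close>. The sign of \<open>d i * D i\<close> then forces
        \<open>D i = 0\<close>, and with it the residual vanishes.\<close>
      case False
      then have "D i = 0" using step[of i] by (auto simp: zero_le_mult_iff)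
      then show ?thesis using step[of i] by simp
    qed
  qed
  have sum2: "summable (\<lambda>i. d (Suc i) * ((res (Suc i))\<^sup>2 / (norm (H (P (Suc i))))\<^sup>2))"
  proof (rule summable_comparison_test)
    show "summable (\<lambda>i. 4 * (d (Suc i) * D (Suc i)))" using sum1 by (rule summable_mult)
    show "\<exists>n0. \<forall>n\<ge>n0. norm (d (Suc n) * ((res (Suc n))\<^sup>2 / (norm (H (P (Suc n))))\<^sup>2))
        \<le> 4 * (d (Suc n) * D (Suc n))"
      using frac by (metis abs_of_nonneg real_norm_def)
  qed
  have "convergent (\<lambda>i. f (P i))" using L by (auto simp: convergent_def)
  then show ?thesis
    using inc global limit kkt limit_St sum1 sum2
    unfolding D_def[abs_def] d_def[abs_def] res_def[abs_def] Let_def by blast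
qed

end
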